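(* Let $\beta(x)=x\sum_{n=0}^{\infty}\beta_nx^n$ be a power series with complex coefficients and $\beta_0\neq0$. Let $\alpha(x)$ be the inverse function of $\beta(x)$. For $m,n\in\mathbb{N}$ we have $$[x^{m+n}]\alpha(x)^m=\frac m{(n+m)!}\sum_{k_1+2k_2+\cdots+nk_n=n}\frac{(n+m-1+k_1+\cdots+k_n)!}{k_1!\cdots k_n!}(-1)^{k_1+k_2+\cdots+k_n}\beta_0^{-n-m-k_1-\cdots-k_n}\beta_1^{k_1}\beta_2^{k_2}\cdots\beta_n^{k_n}.$$
   Context: $\mathbb{N}$ is the set of positive integers. $[x^k]g(x)$ denotes the coefficient of $x^k$ in the power series expansion of $g(x)$. The inverse function is the compositional inverse (as power series with zero constant term): $\alpha(\beta(x))=\beta(\alpha(x))=x$. The sum runs over all $n$-tuples $(k_1,\ldots,k_n)$ of nonnegative integers with $k_1+2k_2+\cdots+nk_n=n$. *)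

theory Defs
  imports "HOL-Computational_Algebra.Formal_Power_Series" "HOL-Library.FuncSet" Complex_Main
begin

text \<open>
  The tuples \<open>(k\<^sub>1, \<dots>, k\<^sub>n)\<close> are represented by extensional functions on \<open>{1..n}\<close>,
  so that each tuple is counted exactly once in a sum over this set.
\<close>
definition weighted_tuples :: "nat \<Rightarrow> (nat \<Rightarrow> nat) set" where
  "weighted_tuples n = {k \<in> {1..n} \<rightarrow>\<^sub>E UNIV. (\<Sum>i=1..n. i * k i) = n}"

lemma finite_weighted_tuples: "finite (weighted_tuples n)"
proof (rule finite_subset)
  show "weighted_tuples n \<subseteq> {1..n} \<rightarrow>\<^sub>E {..n}"
  proof
    fix k assume "k \<in> weighted_tuples n"
    then have ext: "k \<in> {1..n} \<rightarrow>\<^sub>E UNIV" and sum: "(\<Sum>i=1..n. i * k i) = n"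
      by (auto simp: weighted_tuples_def)
    have "k i \<le> n" if i: "i \<in> {1..n}" for i
    proof -
      have "k i \<le> i * k i" using i by simp
      also have "\<dots> \<le> (\<Sum>i=1..n. i * k i)"
        using i by (intro member_le_sum) auto
      finally show ?thesis using sum by simp
    qed
    with ext show "k \<in> {1..n} \<rightarrow>\<^sub>E {..n}" by (auto simp: PiE_iff)
  qed
qed (auto intro: finite_PiE)

end

theory Submission
  imports Defs
begin

text \<open>
  Lagrange inversion: with \<open>\<beta> = x B\<close>, differentiate \<open>\<alpha>\<^sup>m \<circ> \<beta> = x\<^sup>m\<close>, multiply by
  \<open>B\<close> to the power \<open>-(m + n)\<close> and compare coefficients of \<open>x\<close> to the power \<open>m + n - 1\<close>.
  On the left only one term survives, because a derivative has no residue. This gives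
  \<open>(m + n) [x\<^bsup>m+n\<^esup>] \<alpha>\<^sup>m = m [x\<^sup>n] B\<^bsup>-(m+n)\<^esup>\<close>; the right-hand side is then expanded by the
  binomial series in \<open>B / b\<^sub>0 - 1\<close> and the multinomial theorem.
\<close>

section \<open>Multinomial theorem for formal power series\<close>

text \<open>Extensional functions match the encoding of \<open>weighted_tuples\<close>; the
  arbitrary index set \<open>S\<close> allows induction on \<open>S\<close>.\<close>

definition compositions_on :: "'i set \<Rightarrow> nat \<Rightarrow> ('i \<Rightarrow> nat) set" where
  "compositions_on S j = {k \<in> S \<rightarrow>\<^sub>E UNIV. sum k S = j}"

lemma finite_compositions_on:
  assumes "finite S"
  shows "finite (compositions_on S j)"
proof (rule finite_subset)
  show "compositions_on S j \<subseteq> S \<rightarrow>\<^sub>E {..j}"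
  proof
    fix k assume "k \<in> compositions_on S j"
    then show "k \<in> S \<rightarrow>\<^sub>E {..j}"
      using member_le_sum[of _ S k] assms by (auto simp: compositions_on_def PiE_iff)
  qed
qed (use assms in \<open>auto intro: finite_PiE\<close>)

text \<open>Recursion on the index set: \<open>k\<close> corresponds to its value at
  \<open>a\<close> together with \<open>k(a := undefined)\<close>, the reset to
  \<open>undefined\<close> making the second component extensional on \<open>S\<close>.\<close>

lemma sum_compositions_on_insert:
  fixes g :: "('i \<Rightarrow> nat) \<Rightarrow> 'b::comm_monoid_add"
  assumes "finite S" "a \<notin> S"
  shows "(\<Sum>k\<in>compositions_on (insert a S) j. g k) =
         (\<Sum>i\<le>j. \<Sum>k\<in>compositions_on S (j - i). g (k(a := i)))"
proof -
  have "(\<Sum>k\<in>compositions_on (insert a S) j. g k) =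
        (\<Sum>(i, k)\<in>(SIGMA i:{..j}. compositions_on S (j - i)). g (k(a := i)))"
  proof (rule sum.reindex_bij_witness[where i = "\<lambda>(i, k). k(a := i)"
        and j = "\<lambda>k. (k a, k(a := undefined))"], goal_cases)
    case (2 k)
    have "sum (k(a := undefined)) S = sum k S"
      using assms by (intro sum.cong) auto
    with 2 assms show ?case
      by (auto simp: compositions_on_def PiE_def extensional_def)
  next
    case (3 p)
    then show ?case
      using assms by (auto simp: compositions_on_def PiE_def extensional_def fun_eq_iff)
  next
    case (4 p)
    obtain i k where p: "p = (i, k)" by force
    have "sum (k(a := i)) S = sum k S"
      using assms by (intro sum.cong) auto
    with 4 assms p show ?case
      by (auto simp: compositions_on_def PiE_def extensional_def)
  qed (auto simp: fun_eq_iff)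
  also have "\<dots> = (\<Sum>i\<le>j. \<Sum>k\<in>compositions_on S (j - i). g (k(a := i)))"
    using assms by (intro sum.Sigma[symmetric]) (auto intro: finite_compositions_on)
  finally show ?thesis .
qed

text \<open>Induction on \<open>S\<close>: the binomial theorem splits off \<open>f a\<close>, and
  the induction hypothesis expands the power of the remaining sum.\<close>

lemma fps_multinomial:
  fixes f :: "'i \<Rightarrow> 'a::field_char_0 fps"
  assumes "finite S"
  shows "(\<Sum>i\<in>S. f i) ^ j =
    (\<Sum>k\<in>compositions_on S j.
       fps_const (fact j / (\<Prod>i\<in>S. fact (k i))) * (\<Prod>i\<in>S. f i ^ k i))"
  using assms
proof (induction S arbitrary: j rule: finite_induct)
  case empty
  have "compositions_on ({} :: 'i set) j = (if j = 0 then {\<lambda>_. undefined} else {})"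
    by (auto simp: compositions_on_def)
  then show ?case by (cases j) auto
next
  case (insert a S)
  let ?c = "\<lambda>j k. fps_const (fact j / (\<Prod>i\<in>S. fact (k i)) :: 'a)"
  have step: "of_nat (j choose i) * f a ^ i * (?c (j - i) k * (\<Prod>i\<in>S. f i ^ k i)) =
      fps_const (fact j / (\<Prod>l\<in>insert a S. fact ((k(a := i)) l))) *
        (\<Prod>l\<in>insert a S. f l ^ (k(a := i)) l)"
    if "i \<le> j" for i k
  proof -
    have e1: "(\<Prod>l\<in>insert a S. fact ((k(a := i)) l)) = fact i * (\<Prod>l\<in>S. fact (k l) :: 'a)"
      using insert.hyps by (auto intro!: prod.cong)
    have e2: "(\<Prod>l\<in>insert a S. f l ^ (k(a := i)) l) = f a ^ i * (\<Prod>l\<in>S. f l ^ k l)"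
    proof -
      have "(\<Prod>l\<in>S. f l ^ (k(a := i)) l) = (\<Prod>l\<in>S. f l ^ k l)"
        using insert.hyps by (intro prod.cong) auto
      then show ?thesis using insert.hyps by simp
    qed
    \<comment> \<open>The factor \<open>fact (j - i)\<close> of the smaller multinomial coefficient
      cancels against the binomial coefficient.\<close>
    have "of_nat (j choose i) * (fact (j - i) / P) = fact j / (fact i * P)" for P :: 'a
      using that by (simp add: binomial_fact)
    then have "of_nat (j choose i) * ?c (j - i) k =
        fps_const (fact j / (fact i * (\<Prod>i\<in>S. fact (k i))))"
      by (simp flip: fps_of_nat)
    moreover have "c * x * (c' * y) = (c * c') * (x * y)" for c c' x y :: "'a fps"
      by (simp only: mult_ac)
    ultimately show ?thesis
      unfolding e1 e2 by simp
  qed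
  have "(\<Sum>i\<in>insert a S. f i) ^ j =
        (\<Sum>i\<le>j. of_nat (j choose i) * f a ^ i * (\<Sum>i\<in>S. f i) ^ (j - i))"
    unfolding sum.insert[OF insert.hyps] by (rule binomial_ring)
  also have "\<dots> = (\<Sum>i\<le>j. \<Sum>k\<in>compositions_on S (j - i).
      of_nat (j choose i) * f a ^ i * (?c (j - i) k * (\<Prod>i\<in>S. f i ^ k i)))"
    by (simp add: insert.IH sum_distrib_left)
  also have "\<dots> = (\<Sum>i\<le>j. \<Sum>k\<in>compositions_on S (j - i).
      fps_const (fact j / (\<Prod>l\<in>insert a S. fact ((k(a := i)) l))) *
        (\<Prod>l\<in>insert a S. f l ^ (k(a := i)) l))"
    by (intro sum.cong refl step) auto
  finally show ?case
    unfolding sum_compositions_on_insert[OF insert.hyps] .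
qed

section \<open>Coefficients of positive and negative powers\<close>

lemma fps_power_nth_cong:
  fixes f g :: "'a::comm_ring_1 fps"
  assumes "\<And>i. i \<le> n \<Longrightarrow> fps_nth f i = fps_nth g i"
  shows "fps_nth (f ^ j) n = fps_nth (g ^ j) n"
  using assms
proof (induction j arbitrary: n)
  case (Suc j)
  then show ?case by (auto simp: fps_mult_nth intro!: sum.cong)
qed simp

text \<open>For the coefficient of \<open>x^n\<close>, \<open>t\<close> may be replaced by its
  finitely many monomials of degree 1 to \<open>n\<close>. Each term of their multinomial expansion
  is a single monomial, of degree the weighted sum of \<open>k\<close>, so the coefficient selects
  the tuples of weight \<open>n\<close>.\<close>

lemma fps_power_nth_multinomial:
  fixes t :: "'a::field_char_0 fps"
  assumes "fps_nth t 0 = 0"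
  shows "fps_nth (t ^ j) n =
    (\<Sum>k | k \<in> weighted_tuples n \<and> (\<Sum>i=1..n. k i) = j.
       fact j / (\<Prod>i=1..n. fact (k i)) * (\<Prod>i=1..n. fps_nth t i ^ k i))"
proof -
  let ?f = "\<lambda>i. fps_const (fps_nth t i) * fps_X ^ i"
  let ?S = "{1..n}"
  have "fps_nth t i = fps_nth (\<Sum>i\<in>?S. ?f i) i" if "i \<le> n" for i
  proof -
    have "fps_nth (\<Sum>l\<in>?S. ?f l) i = (\<Sum>l\<in>?S. if i = l then fps_nth t l else 0)"
      unfolding fps_sum_nth by (intro sum.cong) auto
    \<comment> \<open>The index 0 lies outside \<open>{1..n}\<close>; there both sides vanish
      because \<open>t\<close> has no constant term.\<close>
    then show ?thesis using that assms by (cases i) auto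
  qed
  then have "fps_nth (t ^ j) n = fps_nth ((\<Sum>i\<in>?S. ?f i) ^ j) n"
    by (rule fps_power_nth_cong)
  also have "\<dots> = (\<Sum>k\<in>compositions_on ?S j.
      if (\<Sum>i\<in>?S. i * k i) = n
      then fact j / (\<Prod>i\<in>?S. fact (k i)) * (\<Prod>i\<in>?S. fps_nth t i ^ k i) else 0)"
  proof -
    have "(\<Prod>i\<in>?S. ?f i ^ k i) =
        fps_const (\<Prod>i\<in>?S. fps_nth t i ^ k i) * fps_X ^ (\<Sum>i\<in>?S. i * k i)" for k
    proof -
      have "(\<Prod>i\<in>?S. fps_const (fps_nth t i) ^ k i) = fps_const (\<Prod>i\<in>?S. fps_nth t i ^ k i)"
        by (induction n) (simp_all add: fps_const_power mult.commute)
      then show ?thesis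
        by (simp add: power_mult_distrib prod.distrib power_sum power_mult)
    qed
    then show ?thesis
      by (auto simp: fps_multinomial fps_sum_nth mult.assoc intro!: sum.cong)
  qed
  also have "\<dots> = (\<Sum>k | k \<in> compositions_on ?S j \<and> (\<Sum>i\<in>?S. i * k i) = n.
      fact j / (\<Prod>i\<in>?S. fact (k i)) * (\<Prod>i\<in>?S. fps_nth t i ^ k i))"
    by (simp add: sum.If_cases finite_compositions_on Int_def)
  also have "{k. k \<in> compositions_on ?S j \<and> (\<Sum>i\<in>?S. i * k i) = n} =
      {k. k \<in> weighted_tuples n \<and> (\<Sum>i\<in>?S. k i) = j}"
    by (auto simp: weighted_tuples_def compositions_on_def)
  finally show ?thesis .
qed

lemma weighted_tuples_sum_le:
  assumes "k \<in> weighted_tuples n"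
  shows "(\<Sum>i=1..n. k i) \<le> n"
proof -
  have "(\<Sum>i=1..n. k i) \<le> (\<Sum>i=1..n. i * k i)"
    by (intro sum_mono) auto
  then show ?thesis using assms by (simp add: weighted_tuples_def)
qed

text \<open>Write \<open>B = c * (1 + u)\<close> with \<open>u\<close> free of a constant term,
  expand \<open>(1 + u)\<close> to the power \<open>-N\<close> by the binomial series, and expand
  each power of \<open>u\<close> by the multinomial formula.\<close>

lemma fps_inverse_power_nth:
  fixes B :: "'a::field_char_0 fps"
  assumes B0: "fps_nth B 0 \<noteq> 0" and N: "N \<ge> 1"
  shows "fps_nth (inverse B ^ N) n =
    (\<Sum>k\<in>weighted_tuples n.
       fact (N - 1 + (\<Sum>i=1..n. k i)) / (fact (N - 1) * (\<Prod>i=1..n. fact (k i))) *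
       (-1) ^ (\<Sum>i=1..n. k i) / fps_nth B 0 ^ (N + (\<Sum>i=1..n. k i)) *
       (\<Prod>i=1..n. fps_nth B i ^ k i))"
proof -
  define c where "c = fps_nth B 0"
  define t where "t = B - fps_const c"
  define u where "u = fps_const (inverse c) * t"
  have c: "c \<noteq> 0" using B0 by (simp add: c_def)
  have t0: "fps_nth t 0 = 0" by (simp add: t_def c_def)
  then have u0: "fps_nth u 0 = 0" by (simp add: u_def)
  have tB: "fps_nth t i = fps_nth B i" if "i \<ge> 1" for i
    using that by (simp add: t_def)
  \<comment> \<open>Writing \<open>1 + u\<close> as a composition lets inverse and power act on
    \<open>1 + fps_X\<close>, where they give the binomial series.\<close>
  have B: "B = fps_const c * ((1 + fps_X) oo u)"
    using c u0 by (simp add: u_def t_def fps_compose_add_distrib ring_distribs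
        flip: mult.assoc)
  have "inverse B ^ N = fps_const (inverse c ^ N) * (inverse (1 + fps_X) oo u) ^ N"
    using u0 by (simp add: B fps_inverse_mult fps_inverse_compose power_mult_distrib
        fps_const_power fps_const_inverse)
  also have "(inverse (1 + fps_X) oo u) ^ N = fps_binomial (- of_nat N) oo u"
    using u0 by (simp add: fps_compose_power fps_binomial_minus_of_nat fps_inverse_power)
  finally have "fps_nth (inverse B ^ N) n =
      inverse c ^ N * (\<Sum>j=0..n. (- of_nat N gchoose j) * fps_nth (u ^ j) n)"
    by (simp add: fps_compose_nth)
  also have "\<dots> = (\<Sum>j\<in>{0..n}. \<Sum>k | k \<in> weighted_tuples n \<and> (\<Sum>i=1..n. k i) = j.
       fact (N - 1 + (\<Sum>i=1..n. k i)) / (fact (N - 1) * (\<Prod>i=1..n. fact (k i))) *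
       (-1) ^ (\<Sum>i=1..n. k i) / c ^ (N + (\<Sum>i=1..n. k i)) *
       (\<Prod>i=1..n. fps_nth B i ^ k i))"
    unfolding sum_distrib_left
  proof (rule sum.cong[OF refl])
    fix j
    have "(- of_nat N gchoose j :: 'a) = (-1) ^ j * of_nat ((N + j - 1) choose j)"
      using N by (simp add: gbinomial_minus binomial_gbinomial of_nat_diff)
    also have "(of_nat ((N + j - 1) choose j) :: 'a) = fact (N - 1 + j) / (fact j * fact (N - 1))"
      using N by (subst binomial_fact) auto
    finally have g: "(- of_nat N gchoose j :: 'a) =
        (-1) ^ j * (fact (N - 1 + j) / (fact j * fact (N - 1)))" .
    have "fps_nth (u ^ j) n = inverse c ^ j * fps_nth (t ^ j) n"
      by (simp add: u_def power_mult_distrib fps_const_power)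
    also have "fps_nth (t ^ j) n =
      (\<Sum>k | k \<in> weighted_tuples n \<and> (\<Sum>i=1..n. k i) = j.
       fact j / (\<Prod>i=1..n. fact (k i)) * (\<Prod>i=1..n. fps_nth B i ^ k i))"
      unfolding fps_power_nth_multinomial[OF t0] by (simp add: tB)
    finally show "inverse c ^ N * ((- of_nat N gchoose j) * fps_nth (u ^ j) n) =
       (\<Sum>k | k \<in> weighted_tuples n \<and> (\<Sum>i=1..n. k i) = j.
       fact (N - 1 + (\<Sum>i=1..n. k i)) / (fact (N - 1) * (\<Prod>i=1..n. fact (k i))) *
       (-1) ^ (\<Sum>i=1..n. k i) / c ^ (N + (\<Sum>i=1..n. k i)) *
       (\<Prod>i=1..n. fps_nth B i ^ k i))"
      unfolding g by (simp only: sum_distrib_left, intro sum.cong refl)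
        (auto simp: power_add field_simps)
  qed
  also have "\<dots> = (\<Sum>k\<in>weighted_tuples n.
       fact (N - 1 + (\<Sum>i=1..n. k i)) / (fact (N - 1) * (\<Prod>i=1..n. fact (k i))) *
       (-1) ^ (\<Sum>i=1..n. k i) / c ^ (N + (\<Sum>i=1..n. k i)) *
       (\<Prod>i=1..n. fps_nth B i ^ k i))"
    \<comment> \<open>The inner sums run over the fibres of the map from \<open>k\<close> to its sum
      of entries, which never exceeds \<open>n\<close>.\<close>
    by (rule sum.group) (use weighted_tuples_sum_le in \<open>auto simp: finite_weighted_tuples\<close>)
  finally show ?thesis unfolding c_def .
qed

section \<open>Lagrange inversion by residues\<close>

text \<open>As \<open>\<beta>\<close> has no constant term, its powers beyond the
  \<open>n\<close>-th do not reach the coefficients up to \<open>n\<close>, so the composition acts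
  as a finite sum.\<close>

lemma fps_compose_mult_nth:
  fixes A \<beta> G :: "'a::comm_ring_1 fps"
  assumes "fps_nth \<beta> 0 = 0"
  shows "fps_nth ((A oo \<beta>) * G) n = (\<Sum>i=0..n. fps_nth A i * fps_nth (\<beta> ^ i * G) n)"
proof -
  have "fps_nth (A oo \<beta>) l = (\<Sum>i=0..n. fps_nth A i * fps_nth (\<beta> ^ i) l)" if "l \<le> n" for l
    unfolding fps_compose_nth
    by (rule sum.mono_neutral_left) (use that assms in \<open>auto simp: startsby_zero_power_prefix\<close>)
  then have "fps_nth ((A oo \<beta>) * G) n =
      (\<Sum>l=0..n. \<Sum>i=0..n. fps_nth A i * fps_nth (\<beta> ^ i) l * fps_nth G (n - l))"
    by (simp add: fps_mult_nth sum_distrib_right)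
  also have "\<dots> = (\<Sum>i=0..n. fps_nth A i * fps_nth (\<beta> ^ i * G) n)"
    by (subst sum.swap) (simp add: fps_mult_nth sum_distrib_left mult.assoc)
  finally show ?thesis .
qed

text \<open>The residue of \<open>\<beta>' / \<beta> ^ (d + 1)\<close>, where \<open>\<beta> = fps_X * B\<close>.\<close>

lemma fps_residue_deriv_power:
  fixes B :: "'a::field_char_0 fps"
  assumes "fps_nth B 0 \<noteq> 0"
  shows "fps_nth (fps_deriv (fps_X * B) * inverse B ^ Suc d) d = (if d = 0 then 1 else 0)"
proof -
  have B: "B * inverse B = 1"
    using assms by (simp add: inverse_mult_eq_1')
  have eq: "fps_deriv (fps_X * B) * inverse B ^ Suc d =
      inverse B ^ d + fps_X * (fps_deriv B * inverse B ^ Suc d)"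
  proof -
    have "fps_deriv (fps_X * B) * inverse B ^ Suc d =
        (B * inverse B) * inverse B ^ d + fps_X * (fps_deriv B * inverse B ^ Suc d)"
      by (simp add: algebra_simps)
    then show ?thesis by (simp add: B)
  qed
  show ?thesis
  proof (cases d)
    case 0
    then show ?thesis unfolding eq by simp
  next
    case (Suc e)
    \<comment> \<open>For \<open>d > 0\<close> the second summand of \<open>eq\<close> is, up to the
      factor \<open>-d\<close>, \<open>fps_X\<close> times a derivative. Comparing coefficients at
      \<open>e = d - 1\<close> shows that the two summands cancel at degree
      \<open>d\<close>.\<close>
    have "fps_deriv (inverse B ^ d) = - of_nat d * (fps_deriv B * inverse B ^ Suc d)"
    proof -
      have "fps_deriv (inverse B ^ d) = - (of_nat d * fps_deriv B * ((inverse B)\<^sup>2 * inverse B ^ e))"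
        by (simp only: fps_deriv_power' fps_inverse_deriv[OF assms])
          (simp add: Suc del: of_nat_Suc)
      then show ?thesis by (simp add: Suc power2_eq_square mult.assoc del: of_nat_Suc)
    qed
    then have "fps_nth (fps_deriv (inverse B ^ d)) e =
        - of_nat d * fps_nth (fps_deriv B * inverse B ^ Suc d) e"
      by (simp add: mult.assoc flip: fps_of_nat fps_const_neg)
    then have "of_nat d * (fps_nth (inverse B ^ d) d + fps_nth (fps_deriv B * inverse B ^ Suc d) e) = 0"
      by (simp add: Suc distrib_left del: power_Suc of_nat_Suc)
    then show ?thesis
      unfolding eq using Suc by (simp del: power_Suc of_nat_Suc)
  qed
qed

lemma Lagrange_inversion:
  fixes \<alpha> B :: "'a::field_char_0 fps"
  assumes B0: "fps_nth B 0 \<noteq> 0" and inv: "\<alpha> oo (fps_X * B) = fps_X" and m: "m \<ge> 1"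
  shows "of_nat (m + n) * fps_nth (\<alpha> ^ m) (m + n) = of_nat m * fps_nth (inverse B ^ (m + n)) n"
proof -
  define \<beta> where "\<beta> = fps_X * B"
  define N where "N = m + n"
  define G where "G = fps_deriv \<beta> * inverse B ^ N"
  have \<beta>0: "fps_nth \<beta> 0 = 0" by (simp add: \<beta>_def)
  have B: "B * inverse B = 1"
    using B0 by (simp add: inverse_mult_eq_1')
  have "(\<alpha> ^ m) oo \<beta> = fps_X ^ m"
    using \<beta>0 inv by (simp add: \<beta>_def flip: fps_compose_power)
  then have "(fps_deriv (\<alpha> ^ m) oo \<beta>) * fps_deriv \<beta> = of_nat m * fps_X ^ (m - 1)"
    using fps_compose_deriv[OF \<beta>0, of "\<alpha> ^ m"] by (simp add: fps_deriv_power flip: fps_of_nat)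
  then have "(fps_deriv (\<alpha> ^ m) oo \<beta>) * G = of_nat m * (fps_X ^ (m - 1) * inverse B ^ N)"
    by (simp add: G_def flip: mult.assoc)
  then have "fps_nth ((fps_deriv (\<alpha> ^ m) oo \<beta>) * G) (N - 1) = of_nat m * fps_nth (inverse B ^ N) n"
    using m by (simp add: N_def fps_X_power_mult_nth flip: fps_of_nat)
  \<comment> \<open>Cancelling \<open>B ^ i\<close> leaves \<open>fps_X ^ i\<close> times the series
    of the residue lemma with \<open>d = N - 1 - i\<close>, so only \<open>i = N - 1\<close>
    survives.\<close>
  moreover have "fps_nth (\<beta> ^ i * G) (N - 1) = (if i = N - 1 then 1 else 0)" if "i \<le> N - 1" for i
  proof -
    have N: "N = i + Suc (N - 1 - i)" using that m by (simp add: N_def)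
    have "\<beta> ^ i * G = fps_X ^ i * ((B * inverse B) ^ i * (fps_deriv \<beta> * inverse B ^ Suc (N - 1 - i)))"
      unfolding G_def by (subst N) (simp only: \<beta>_def power_mult_distrib power_add mult_ac)
    then have "fps_nth (\<beta> ^ i * G) (N - 1) =
        fps_nth (fps_deriv \<beta> * inverse B ^ Suc (N - 1 - i)) (N - 1 - i)"
      using that by (simp add: B fps_X_power_mult_nth del: power_Suc)
    then show ?thesis
      using that fps_residue_deriv_power[OF B0, of "N - 1 - i"] by (auto simp: \<beta>_def)
  qed
  then have "fps_nth ((fps_deriv (\<alpha> ^ m) oo \<beta>) * G) (N - 1) =
      (\<Sum>i=0..N-1. if i = N - 1 then fps_nth (fps_deriv (\<alpha> ^ m)) i else 0)"
    unfolding fps_compose_mult_nth[OF \<beta>0] by (intro sum.cong) auto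
  ultimately have "of_nat m * fps_nth (inverse B ^ N) n =
      (\<Sum>i=0..N-1. if i = N - 1 then fps_nth (fps_deriv (\<alpha> ^ m)) i else 0)"
    by simp
  also have "\<dots> = fps_nth (fps_deriv (\<alpha> ^ m)) (N - 1)"
    by (simp del: fps_deriv_nth)
  also have "\<dots> = of_nat N * fps_nth (\<alpha> ^ m) N"
    using m by (simp add: N_def)
  finally show ?thesis by (simp add: N_def)
qed

theorem theorem4p1:
  fixes b :: "nat \<Rightarrow> complex" and \<alpha> \<beta> :: "complex fps" and m n :: nat
  assumes "\<beta> = fps_X * Abs_fps b"
    and "b 0 \<noteq> 0"
    and "fps_nth \<alpha> 0 = 0"
    and "fps_compose \<alpha> \<beta> = fps_X"
    and "fps_compose \<beta> \<alpha> = fps_X"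
    and "m \<ge> 1"
    and "n \<ge> 1"
  shows "fps_nth (\<alpha> ^ m) (m + n) =
    of_nat m / fact (n + m) *
    (\<Sum>k\<in>weighted_tuples n.
       fact (n + m - 1 + (\<Sum>i=1..n. k i)) / (\<Prod>i=1..n. fact (k i)) *
       (-1) ^ (\<Sum>i=1..n. k i) *
       b 0 powi (- int n - int m - int (\<Sum>i=1..n. k i)) *
       (\<Prod>i=1..n. b i ^ k i))"
proof -
  define N where "N = m + n"
  have N: "N \<ge> 1" "n + m = N" using assms by (auto simp: N_def)
  \<comment> \<open>Merges the \<open>1 / N\<close> from Lagrange inversion with the
    \<open>fact (N - 1)\<close> in the denominator of the binomial series coefficients.\<close>
  have fact_N: "(fact N :: complex) = of_nat N * fact (N - 1)"
    using N by (simp add: fact_reduce)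
  have powi: "b 0 powi (- int n - int m - int s) = 1 / b 0 ^ (N + s)" for s
  proof -
    have "- int n - int m - int s = - int (N + s)" by (simp add: N_def)
    then show ?thesis by (simp only: power_int_minus power_int_of_nat inverse_eq_divide)
  qed
  have "of_nat N * fps_nth (\<alpha> ^ m) N = of_nat m * fps_nth (inverse (Abs_fps b) ^ N) n"
    unfolding N_def by (rule Lagrange_inversion) (use assms in auto)
  then have "fps_nth (\<alpha> ^ m) N = of_nat m / of_nat N * fps_nth (inverse (Abs_fps b) ^ N) n"
    using N by (simp add: field_simps)
  also have "\<dots> = of_nat m / fact N * (\<Sum>k\<in>weighted_tuples n.
       fact (N - 1 + (\<Sum>i=1..n. k i)) / (\<Prod>i=1..n. fact (k i)) *
       (-1) ^ (\<Sum>i=1..n. k i) *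
       b 0 powi (- int n - int m - int (\<Sum>i=1..n. k i)) *
       (\<Prod>i=1..n. b i ^ k i))"
    unfolding powi sum_distrib_left using assms(2) N(1)
    by (simp add: fps_inverse_power_nth sum_distrib_left fact_N mult_ac)
  finally show ?thesis unfolding N(2) N_def[symmetric] .
qed

end
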